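(* Let $u$ be a real number, let $\epsilon = 2u$, and assume $0 < 4\epsilon < 1-u$. Let $\alpha$ and $\Omega$ be real numbers with $0<\alpha<\Omega$, and assume that $$\alpha = \frac{4\epsilon}{(1-u)\,\Omega}.$$ Let $b, c, d$ be real numbers in the interval $[\alpha,\Omega]$ such that $d \leq c$. If $$\frac{d}{c} < \alpha \quad\text{and}\quad \frac{b}{c} < \alpha,$$ then $$\frac{bd}{c} < \alpha.$$
   Context: All quantities are real numbers and all operations are exact real arithmetic. The interpretation is in terms of a floating point system: $u$ represents the unit roundoff, $\epsilon=2u$ the machine epsilon, $\alpha$ the smallest positive (subnormal) number, and $\Omega$ the largest positive number. No property of floating point arithmetic beyond the hypotheses listed is used in the statement. *)

theory Defs
  imports Complex_Main
begin

end

theory Submission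
  imports Defs
begin

text \<open>The smallness of \<open>b / c\<close> forces \<open>b < 1\<close>: since
  \<open>c\<close> is at most \<Omega>, \<open>b\<close> lies below \<alpha> * \<Omega>, and the
  formula for \<alpha> makes this product 4 * \<epsilon> / (1 - u), which is less than 1.
  Multiplying the positive quotient \<open>d / c\<close>, itself below \<alpha>, by such a
  \<open>b\<close> can only keep it below \<alpha>.\<close>

theorem proposition3p1:
  fixes u \<epsilon> \<alpha> \<Omega> b c d :: real
  assumes "\<epsilon> = 2 * u"
    and "0 < 4 * \<epsilon>" and "4 * \<epsilon> < 1 - u"
    and "0 < \<alpha>" and "\<alpha> < \<Omega>"
    and "\<alpha> = 4 * \<epsilon> / ((1 - u) * \<Omega>)"
    and "b \<in> {\<alpha>..\<Omega>}" and "c \<in> {\<alpha>..\<Omega>}" and "d \<in> {\<alpha>..\<Omega>}"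
    and "d \<le> c"
    and "d / c < \<alpha>" and "b / c < \<alpha>"
  shows "b * d / c < \<alpha>"
proof -
  have c: "0 < c" "c \<le> \<Omega>" and d: "0 < d"
    using assms by auto
  have u: "0 < 1 - u" and \<Omega>: "0 < \<Omega>"
    using assms by linarith+
  have "b < \<alpha> * c"
    using assms(12) c by (simp add: pos_divide_less_eq)
  also have "\<dots> \<le> \<alpha> * \<Omega>"
    using c assms(4) by simp
  also have "\<dots> = 4 * \<epsilon> / (1 - u)"
    using assms(6) \<Omega> by simp
  also have "\<dots> < 1"
    using assms(3) u by simp
  \<comment> \<open>The chain has given \<open>b < 1\<close>; the explicit factor 1 lets
    \<open>mult_strict_right_mono\<close> scale it by \<open>d / c\<close>, which is
    positive.\<close>
  finally have "b * (d / c) < 1 * (d / c)"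
    using c d by (intro mult_strict_right_mono) auto
  then show ?thesis
    using assms(11) by simp
qed

end
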